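(* $\xi_{n,2}=1-\dfrac{1}{n}$ for every integer $n\geq 2$.
   Context: Let $X$ be a finite alphabet with $n\ge 2$ letters. For positive integers $a,b$, a code with length distribution $(a,b)$ is a pair $(v_1,v_2)$ of words over $X$ with $|v_1|=a$ and $|v_2|=b$. It is a prefix code if $v_1\neq v_2$ and neither word is a prefix (initial segment) of the other. It is uniquely decodable if $v_{i_1}v_{i_2}\cdots v_{i_t}=v_{j_1}v_{j_2}\cdots v_{j_{t'}}$ with $t,t'\geq 1$ and all indices in $\{1,2\}$ implies $t=t'$ and $i_s=j_s$ for every $1\leq s\leq t$. $UD_n((a,b))$ denotes the set of uniquely decodable codes over an $n$-letter alphabet with length distribution $(a,b)$, and $PR_n((a,b))\subseteq UD_n((a,b))$ the subset of prefix codes. Define $$\xi_{n,2}:=\inf_{L}\frac{|PR_n(L)|}{|UD_n(L)|},$$ where the infimum is over all pairs $L=(a,b)$ of positive integers for which $UD_n(L)\neq\emptyset$. *)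

theory Defs
  imports Complex_Main "HOL-Library.Sublist"
begin

definition codes :: "'a set \<Rightarrow> nat \<times> nat \<Rightarrow> ('a list \<times> 'a list) set" where
  "codes X L = {(v1, v2). v1 \<in> lists X \<and> v2 \<in> lists X \<and> length v1 = fst L \<and> length v2 = snd L}"

definition is_prefix_code :: "'a list \<times> 'a list \<Rightarrow> bool" where
  "is_prefix_code v \<longleftrightarrow> fst v \<noteq> snd v \<and> \<not> prefix (fst v) (snd v) \<and> \<not> prefix (snd v) (fst v)"

text \<open>Only the indices \<open>1\<close> and \<open>2\<close> are meaningful.\<close>
definition codeword :: "'a list \<times> 'a list \<Rightarrow> nat \<Rightarrow> 'a list" where
  "codeword v i = (if i = 1 then fst v else snd v)"

definition is_uniquely_decodable :: "'a list \<times> 'a list \<Rightarrow> bool" where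
  "is_uniquely_decodable v \<longleftrightarrow>
    (\<forall>is js. is \<noteq> [] \<and> js \<noteq> [] \<and> set is \<subseteq> {1, 2} \<and> set js \<subseteq> {1, 2} \<and>
       concat (map (codeword v) is) = concat (map (codeword v) js) \<longrightarrow> is = js)"

definition UD :: "'a set \<Rightarrow> nat \<times> nat \<Rightarrow> ('a list \<times> 'a list) set" where
  "UD X L = {v \<in> codes X L. is_uniquely_decodable v}"

definition PR :: "'a set \<Rightarrow> nat \<times> nat \<Rightarrow> ('a list \<times> 'a list) set" where
  "PR X L = {v \<in> codes X L. is_prefix_code v}"

definition xi2 :: "'a set \<Rightarrow> real" where
  "xi2 X = (INF L \<in> {(a, b). a > 0 \<and> b > 0 \<and> UD X (a, b) \<noteq> {}}.
              real (card (PR X L)) / real (card (UD X L)))"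

lemma is_prefix_code_imp_uniquely_decodable:
  assumes "is_prefix_code v"
  shows "is_uniquely_decodable v"
proof -
  have ne: "codeword v i \<noteq> []" for i
    using assms by (auto simp: is_prefix_code_def codeword_def)
  have pre: "i = j" if i: "i \<in> {1, 2}" and j: "j \<in> {1, 2}"
    and eq: "codeword v i @ xs = codeword v j @ ys" for i j :: nat and xs ys
  proof (rule ccontr)
    assume "i \<noteq> j"
    have "prefix (codeword v i) (codeword v j @ ys)" "prefix (codeword v j) (codeword v j @ ys)"
      unfolding eq[symmetric] by (rule prefixI, rule refl) (simp add: eq)
    then have "prefix (codeword v i) (codeword v j) \<or> prefix (codeword v j) (codeword v i)"
      by (rule prefix_same_cases)
    moreover have "i = 1 \<and> j = 2 \<or> i = 2 \<and> j = 1"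
      using i j \<open>i \<noteq> j\<close> by blast
    ultimately show False
      using assms by (elim disjE conjE) (simp_all add: is_prefix_code_def codeword_def)
  qed
  have "is = js" if "set is \<subseteq> {1, 2}" "set js \<subseteq> {1, 2}"
    "concat (map (codeword v) is) = concat (map (codeword v) js)" for "is" js
    using that
  proof (induction "is" arbitrary: js)
    case Nil
    then show ?case using ne by (cases js) auto
  next
    case (Cons i "is")
    obtain j js' where js: "js = j # js'"
      using Cons.prems(3) ne by (cases js) simp_all
    have "codeword v i @ concat (map (codeword v) is) = codeword v j @ concat (map (codeword v) js')"
      using Cons.prems(3) js by simp
    moreover have "i \<in> {1, 2}" "j \<in> {1, 2}" using Cons.prems(1,2) js by simp_all
    ultimately have "i = j" using pre by blast
    moreover have "is = js'"
      using Cons.prems js \<open>i = j\<close> by (intro Cons.IH) simp_all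
    ultimately show ?case using js by simp
  qed
  then show ?thesis unfolding is_uniquely_decodable_def by blast
qed

lemma PR_subset_UD: "PR X L \<subseteq> UD X L"
  using is_prefix_code_imp_uniquely_decodable by (auto simp: PR_def UD_def)

end

theory Submission
  imports Defs
begin

text \<open>Exactly \<open>n ^ max a b\<close> of the \<open>n ^ (a + b)\<close> pairs of words of lengths \<open>a\<close> and \<open>b\<close> fail to be
  a prefix code, since such a pair is determined by its longer word. Hence the proportion of prefix
  codes is \<open>1 - 1 / n ^ min a b \<ge> 1 - 1 / n\<close> already among all pairs. Conversely, two words that do
  not commute form a uniquely decodable code, so at most the \<open>n\<close> pairs \<open>([x], x\<^sup>b)\<close> are missing from
  \<open>UD\<close> for the distribution \<open>(1, b)\<close>, and the ratio there tends to \<open>1 - 1 / n\<close>.\<close>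

text \<open>Induction on the total length of the two words. Where the factor lists first differ, one
  word is a prefix of the other, say \<open>q = p @ z\<close>. Splitting every \<open>q\<close> into
  \<open>p, z\<close> gives two factorizations over the shorter pair \<open>p\<close>,
  \<open>z\<close>. These commute, and hence so do \<open>p\<close> and \<open>q\<close>.\<close>

lemma commute_if_two_factorizations:
  assumes "ws \<in> lists {u, v}" "ws' \<in> lists {u, v}" "concat ws = concat ws'" "ws \<noteq> ws'"
  shows "u @ v = v @ u"
  using assms
proof (induction "length u + length v" arbitrary: u v ws ws' rule: less_induct)
  case less
  show ?case
  proof (rule ccontr)
    assume nc: "u @ v \<noteq> v @ u"
    \<comment> \<open>If one list extended the other, the surplus factors would be empty words, and
      the empty word commutes with every word.\<close>
    have no_proper_prefix: False
      if "xs = ys @ zs" "xs \<in> lists {u, v}" "concat xs = concat ys" "xs \<noteq> ys" for xs ys zs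
    proof -
      have "concat zs = []" "zs \<noteq> []" "set zs \<subseteq> {u, v}" using that by auto
      then have "[] \<in> {u, v}" by (cases zs) auto
      then show False using nc by auto
    qed
    have "ws \<parallel> ws'"
    proof (rule parallelI)
      show "\<not> prefix ws ws'"
        using no_proper_prefix less.prems by (metis prefixE)
      show "\<not> prefix ws' ws"
        using no_proper_prefix less.prems by (metis prefixE)
    qed
    then obtain as b bs c cs where ne: "b \<noteq> c" and ws: "ws = as @ b # bs" and ws': "ws' = as @ c # cs"
      using parallel_decomp by blast
    have mem: "b \<in> {u, v}" "c \<in> {u, v}" "bs \<in> lists {u, v}" "cs \<in> lists {u, v}"
      and eq: "b @ concat bs = c @ concat cs"
      using less.prems ws ws' by auto
    \<comment> \<open>By symmetry, \<open>p\<close> names the shorter of the two differing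
      factors.\<close>
    obtain p q ps qs where pq: "p \<noteq> q" "{p, q} = {u, v}" "ps \<in> lists {p, q}" "qs \<in> lists {p, q}"
      "p @ concat ps = q @ concat qs" "length p \<le> length q"
    proof (cases "length b \<le> length c")
      case True
      have "{b, c} = {u, v}" using ne mem by blast
      then show thesis using that[of b c bs cs] ne mem eq True by simp
    next
      case False
      have "{c, b} = {u, v}" using ne mem by blast
      then show thesis using that[of c b cs bs] ne mem eq False by simp
    qed
    have nc': "p @ q \<noteq> q @ p" using nc pq(2) by (metis doubleton_eq_iff)
    have len: "length p + length q = length u + length v"
      using pq(2) by (metis doubleton_eq_iff add.commute)
    obtain z where z: "q = p @ z"
      using pq(5,6) by (metis append_eq_append_conv_if append_take_drop_id)
    have pz: "p @ z \<noteq> z @ p" using nc' z by auto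
    \<comment> \<open>On \<open>p\<close> and \<open>q\<close> this is the substitution that fixes
      \<open>p\<close> and splits \<open>q\<close> into \<open>p, z\<close>.\<close>
    define f where "f w = (if w = p then [p] else [p, z])" for w
    define F where "F xs = concat (map f xs)" for xs
    have F_lists: "F xs \<in> lists {p, z}" for xs
      by (induction xs) (auto simp: F_def f_def)
    have F_concat: "concat (F xs) = concat xs" if "xs \<in> lists {p, q}" for xs
      using that by (induction xs) (auto simp: F_def f_def z)
    have F_hd: "F xs = [] \<or> hd (F xs) = p" for xs
      by (cases xs) (auto simp: F_def f_def)
    \<comment> \<open>Behind the common leading \<open>p\<close>, the right side continues with
      \<open>z\<close>, while the left side ends or continues with \<open>p\<close>. Equality would
      force \<open>z = p\<close>.\<close>
    have "F (p # ps) \<noteq> F (q # qs)"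
    proof
      assume "F (p # ps) = F (q # qs)"
      then have "F ps = z # F qs" using pq(1) by (simp add: F_def f_def)
      then have "z = p" using F_hd[of ps] by simp
      then show False using pz by simp
    qed
    moreover have "concat (F (p # ps)) = concat (F (q # qs))"
      using pq(3-5) by (simp add: F_concat)
    \<comment> \<open>The left side is \<open>length q\<close>, and \<open>p\<close> is nonempty
      because it does not commute with \<open>z\<close>.\<close>
    moreover have "length p + length z < length u + length v"
      using len z pz by (cases p) auto
    ultimately have "p @ z = z @ p"
      using less.hyps F_lists by blast
    then show False using pz by simp
  qed
qed

text \<open>Non-commuting words are distinct, so a list of codewords determines its list of indices,
  and two decodings would be two factorizations.\<close>

lemma uniquely_decodable_if_not_commute:
  assumes "u @ v \<noteq> v @ u"
  shows "is_uniquely_decodable (u, v)"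
  unfolding is_uniquely_decodable_def
proof (intro allI impI, elim conjE)
  fix is' js :: "nat list"
  assume sub: "set is' \<subseteq> {1, 2}" "set js \<subseteq> {1, 2}"
    and eq: "concat (map (codeword (u, v)) is') = concat (map (codeword (u, v)) js)"
  have "map (codeword (u, v)) xs \<in> lists {u, v}" for xs
    by (auto simp: codeword_def)
  then have "map (codeword (u, v)) is' = map (codeword (u, v)) js"
    using commute_if_two_factorizations[OF _ _ eq] assms by metis
  moreover have "inj_on (codeword (u, v)) {1, 2}"
    using assms by (auto simp: inj_on_def codeword_def)
  then have "inj_on (codeword (u, v)) (set is' \<union> set js)"
    by (rule inj_on_subset) (use sub in simp)
  ultimately show "is' = js" by (simp add: inj_on_map_eq_map)
qed

lemma singleton_commute_imp_replicate:
  "[x] @ w = w @ [x] \<Longrightarrow> replicate (length w) x = w"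
  by (induction w) auto

lemma
  assumes "finite X"
  shows finite_codes: "finite (codes X (a, b))"
    and card_codes: "card (codes X (a, b)) = card X ^ (a + b)"
proof -
  have codes: "codes X (a, b) =
      {xs. set xs \<subseteq> X \<and> length xs = a} \<times> {xs. set xs \<subseteq> X \<and> length xs = b}"
    by (auto simp: codes_def)
  show "finite (codes X (a, b))"
    using assms by (simp add: codes finite_lists_length_eq)
  show "card (codes X (a, b)) = card X ^ (a + b)"
    using assms by (simp add: codes card_cartesian_product card_lists_length_eq power_add)
qed

text \<open>When one word is a prefix of the other, both are initial segments of the longer one,
  which serves as \<open>w\<close>. The case of equal words is included.\<close>

lemma not_prefix_codes_eq_image:
  "codes X (a, b) - PR X (a, b) =
    (\<lambda>w. (take a w, take b w)) ` {w. set w \<subseteq> X \<and> length w = max a b}" (is "?L = ?f ` ?W")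
proof
  show "?L \<subseteq> ?f ` ?W"
  proof
    fix p assume "p \<in> ?L"
    then obtain u v where p: "p = (u, v)" and uv: "set u \<subseteq> X" "set v \<subseteq> X" "length u = a" "length v = b"
      and "prefix u v \<or> prefix v u"
      by (cases p) (auto simp: codes_def PR_def is_prefix_code_def subset_iff)
    then consider "prefix u v" | "prefix v u" by blast
    then show "p \<in> ?f ` ?W"
    proof cases
      case 1
      then show ?thesis using uv p by (intro image_eqI[of _ _ v]) (auto simp: prefix_def)
    next
      case 2
      then show ?thesis using uv p by (intro image_eqI[of _ _ u]) (auto simp: prefix_def)
    qed
  qed
  show "?f ` ?W \<subseteq> ?L"
  proof
    fix p assume "p \<in> ?f ` ?W"
    then obtain w where p: "p = (take a w, take b w)" and w: "set w \<subseteq> X" "length w = max a b"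
      by blast
    have "prefix (take a w) (take b w) \<or> prefix (take b w) (take a w)"
      using take_is_prefix prefix_same_cases by blast
    then show "p \<in> ?L"
      using p w by (auto simp: codes_def PR_def is_prefix_code_def dest: in_set_takeD)
  qed
qed

lemma card_PR:
  assumes "finite X"
  shows "real (card (PR X (a, b))) = real (card X) ^ (a + b) - real (card X) ^ max a b"
proof -
  let ?W = "{w. set w \<subseteq> X \<and> length w = max a b}"
  \<comment> \<open>One of the two components is \<open>w\<close> itself, since \<open>w\<close> has
    length \<open>max a b\<close>.\<close>
  have "inj_on (\<lambda>w. (take a w, take b w)) ?W"
    by (rule inj_onI) (auto simp: max_def split: if_splits)
  then have "card (codes X (a, b) - PR X (a, b)) = card X ^ max a b"
    using assms by (simp add: not_prefix_codes_eq_image card_image card_lists_length_eq)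
  moreover have "PR X (a, b) \<subseteq> codes X (a, b)"
    by (auto simp: PR_def)
  then have "card (codes X (a, b)) = card (codes X (a, b) - PR X (a, b)) + card (PR X (a, b))"
    using finite_codes[OF assms, of a b] by (metis card_Diff_subset card_mono finite_subset le_add_diff_inverse2)
  ultimately have "real (card X ^ (a + b)) = real (card X ^ max a b + card (PR X (a, b)))"
    using card_codes[OF assms, of a b] by simp
  then show ?thesis by simp
qed

lemma card_UD_le:
  assumes "finite X"
  shows "real (card (UD X (a, b))) \<le> real (card X) ^ (a + b)"
proof -
  have "card (UD X (a, b)) \<le> card (codes X (a, b))"
    using finite_codes[OF assms] by (intro card_mono) (auto simp: UD_def)
  then have "real (card (UD X (a, b))) \<le> real (card X ^ (a + b))"
    using card_codes[OF assms, of a b] by simp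
  then show ?thesis by simp
qed

text \<open>A word that commutes with the letter \<open>x\<close> is a power of \<open>x\<close>, so
  each letter accounts for at most one code that is not uniquely decodable.\<close>

lemma card_UD_one_ge:
  assumes "finite X"
  shows "real (card X) ^ (b + 1) - real (card X) \<le> real (card (UD X (1, b)))"
proof -
  let ?C = "(\<lambda>x. ([x], replicate b x)) ` X"
  have "codes X (1, b) \<subseteq> UD X (1, b) \<union> ?C"
  proof
    fix p assume p: "p \<in> codes X (1, b)"
    then obtain x w where xw: "p = ([x], w)" "x \<in> X" "length w = b"
      by (auto simp: codes_def length_Suc_conv)
    show "p \<in> UD X (1, b) \<union> ?C"
    proof (cases "[x] @ w = w @ [x]")
      case True
      then have "replicate b x = w" using xw(3) singleton_commute_imp_replicate by metis
      then show ?thesis using xw by auto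
    next
      case False
      then show ?thesis using xw p uniquely_decodable_if_not_commute[OF False] by (simp add: UD_def)
    qed
  qed
  moreover have "finite (UD X (1, b))"
    using finite_codes[OF assms] by (rule finite_subset[rotated]) (auto simp: UD_def)
  ultimately have "card (codes X (1, b)) \<le> card (UD X (1, b) \<union> ?C)"
    using assms by (intro card_mono) auto
  also have "\<dots> \<le> card (UD X (1, b)) + card ?C"
    by (rule card_Un_le)
  also have "\<dots> \<le> card (UD X (1, b)) + card X"
    using card_image_le[OF assms] by simp
  finally have "real (card X ^ (1 + b)) \<le> real (card (UD X (1, b)) + card X)"
    using card_codes[OF assms, of 1 b] by (simp only: of_nat_le_iff)
  then show ?thesis by simp
qed

theorem corollary5:
  fixes X :: "'a set" and n :: nat
  assumes "finite X" and "card X = n" and "n \<ge> 2"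
  shows "xi2 X = 1 - 1 / real n"
proof (rule antisym)
  let ?I = "{(a, b). a > 0 \<and> b > 0 \<and> UD X (a, b) \<noteq> {}}"
  let ?r = "\<lambda>L. real (card (PR X L)) / real (card (UD X L))"
  have n: "real n \<ge> 2" using assms(3) by simp
  have UD_one_pos: "0 < real n ^ (b + 1) - real n" if "b > 0" for b
    using n that power_strict_increasing[of 1 "b + 1" "real n"] by simp
  have in_I: "(1, b) \<in> ?I" if "b > 0" for b
  proof -
    have "0 < real (card (UD X (1, b)))"
      using UD_one_pos[OF that] card_UD_one_ge[OF assms(1), of b] assms(2) by simp
    then show ?thesis using that by auto
  qed
  show "1 - 1 / real n \<le> xi2 X"
    unfolding xi2_def
  proof (rule cINF_greatest)
    show "?I \<noteq> {}" using in_I[OF zero_less_one] by (intro notI) (simp only: empty_iff)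
    fix L assume "L \<in> ?I"
    then obtain a b where L: "L = (a, b)" "a > 0" "b > 0" "UD X (a, b) \<noteq> {}" by auto
    have "finite (UD X (a, b))"
      using finite_codes[OF assms(1)] by (rule finite_subset[rotated]) (auto simp: UD_def)
    then have pos: "0 < real (card (UD X (a, b)))" using L by (simp add: card_gt_0_iff)
    \<comment> \<open>Since \<open>min a b\<close> \<ge> 1, the exponent \<open>a + b\<close> is at
      least \<open>max a b + 1\<close>.\<close>
    have le: "real n * real n ^ max a b \<le> real n ^ (a + b)"
      unfolding power_Suc[symmetric] using n L by (intro power_increasing) auto
    have "(1 - 1 / real n) * real (card (UD X (a, b))) \<le> (1 - 1 / real n) * real n ^ (a + b)"
      using card_UD_le[OF assms(1), of a b] assms(2) n by (intro mult_left_mono) auto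
    also have "\<dots> \<le> real (card (PR X (a, b)))"
      using le n assms(2) by (simp add: card_PR[OF assms(1)] field_simps)
    finally show "1 - 1 / real n \<le> ?r L"
      using pos L by (simp add: le_divide_eq)
  qed
  have bound: "xi2 X \<le> (1 - 1 / real n) / (1 - (1 / real n) ^ b)" if "b > 0" for b
  proof -
    have "xi2 X \<le> ?r (1, b)"
      unfolding xi2_def
      \<comment> \<open>All ratios are bounded below by 0, so the infimum is a genuine lower
        bound.\<close>
      by (rule cINF_lower) (use in_I[OF that] in \<open>auto intro!: bdd_belowI[of _ 0]\<close>)
    also have "\<dots> \<le> real (card (PR X (1, b))) / (real n ^ (b + 1) - real n)"
      using UD_one_pos[OF that] card_UD_one_ge[OF assms(1), of b] assms(2)
      by (intro divide_left_mono) auto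
    also have "\<dots> = (real n ^ (b + 1) - real n ^ b) / (real n ^ (b + 1) - real n)"
      using that assms(2) by (simp add: card_PR[OF assms(1)] max_def)
    also have "\<dots> = (1 - 1 / real n) / (1 - (1 / real n) ^ b)"
    proof -
      \<comment> \<open>Factoring out \<open>real n ^ (b + 1)\<close> leaves an expression whose
        limit is visible.\<close>
      have "real n ^ (b + 1) - real n ^ b = real n ^ (b + 1) * (1 - 1 / real n)"
        "real n ^ (b + 1) - real n = real n ^ (b + 1) * (1 - (1 / real n) ^ b)"
        using n by (auto simp: field_simps power_divide)
      then show ?thesis using n by simp
    qed
    finally show ?thesis .
  qed
  have "(\<lambda>b. (1 / real n) ^ b) \<longlonglongrightarrow> 0"
    using n by (intro LIMSEQ_power_zero) auto
  then have "(\<lambda>b. (1 - 1 / real n) / (1 - (1 / real n) ^ b)) \<longlonglongrightarrow> (1 - 1 / real n) / (1 - 0)"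
    by (intro tendsto_divide tendsto_diff tendsto_const) auto
  then have "(\<lambda>b. (1 - 1 / real n) / (1 - (1 / real n) ^ b)) \<longlonglongrightarrow> 1 - 1 / real n"
    by simp
  then show "xi2 X \<le> 1 - 1 / real n"
    \<comment> \<open>The bound is used from \<open>b = 1\<close> on. At \<open>b = 0\<close> the
      denominator vanishes and the quotient is 0 by convention.\<close>
    by (rule LIMSEQ_le_const) (use bound in \<open>auto intro!: exI[of _ 1]\<close>)
qed

end
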